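(* (Global cover theorem) For every instance of the Square Strip Packing Problem and every ordering of its squares, the unoccupied space of the bottom-left packing within the substrip $[0,W]\times[0,h_{\text{BL}}-3h_{\text{max}}]$ can be covered by at most twelve copies of the squares of the instance; that is, there is a family of translates of the squares, in which each square of the instance is used at most twelve times, whose union contains all points of $[0,W]\times[0,h_{\text{BL}}-3h_{\text{max}}]$ not covered by the packed squares.
   Context: Square Strip Packing Problem: squares with side lengths at most $W$ are to be packed without rotation into the strip $[0,W]\times[0,\infty)$ with pairwise disjoint interiors. Bottom-left algorithm: given an ordering, place the first square at $(0,0)$ and each subsequent square at a feasible position $(x,y)$ (its lower-left corner) with $(y,x)$ lexicographically minimal. $h_{\text{BL}}$ is the height (maximum top coordinate) of the resulting packing and $h_{\text{max}}$ the largest side length of a square in the instance. *)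

theory Defs
  imports Complex_Main
begin

type_synonym point = "real \<times> real"

definition sq :: "point \<Rightarrow> real \<Rightarrow> point set" where
  "sq p a = {fst p .. fst p + a} \<times> {snd p .. snd p + a}"

definition sq_int :: "point \<Rightarrow> real \<Rightarrow> point set" where
  "sq_int p a = {fst p <..< fst p + a} \<times> {snd p <..< snd p + a}"

definition valid_instance :: "real \<Rightarrow> real list \<Rightarrow> bool" where
  "valid_instance W s \<longleftrightarrow> W > 0 \<and> (\<forall>a \<in> set s. 0 < a \<and> a \<le> W)"

definition feasible :: "real \<Rightarrow> real list \<Rightarrow> (nat \<Rightarrow> point) \<Rightarrow> nat \<Rightarrow> point \<Rightarrow> bool" where
  "feasible W s pos k p \<longleftrightarrow>
     0 \<le> fst p \<and> fst p + s ! k \<le> W \<and> 0 \<le> snd p \<and>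
     (\<forall>j<k. sq_int p (s ! k) \<inter> sq_int (pos j) (s ! j) = {})"

text \<open>pos is the bottom-left packing of the ordered instance s: each square k
  is placed at the feasible position (x,y) with (y,x) lexicographically minimal
  (given the placements of the previous squares).  For k = 0 this forces (0,0).\<close>
definition bl_packing :: "real \<Rightarrow> real list \<Rightarrow> (nat \<Rightarrow> point) \<Rightarrow> bool" where
  "bl_packing W s pos \<longleftrightarrow>
     (\<forall>k < length s. feasible W s pos k (pos k) \<and>
        (\<forall>q. feasible W s pos k q \<longrightarrow>
              snd (pos k) < snd q \<or> (snd (pos k) = snd q \<and> fst (pos k) \<le> fst q)))"

definition h_BL :: "real list \<Rightarrow> (nat \<Rightarrow> point) \<Rightarrow> real" where
  "h_BL s pos = Max {snd (pos i) + s ! i | i. i < length s}"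

definition h_max :: "real list \<Rightarrow> real" where
  "h_max s = Max (set s)"

end

theory Submission
  imports Defs
begin

text \<open>Let \<open>(x, y)\<close> be a point and let \<open>k\<close> be a square of side \<open>c\<close> placed above height \<open>y + c\<close>. Square
  \<open>k\<close> did not fit at height \<open>y + c\<close> in a window of width \<open>c\<close> around \<open>x\<close>, so an earlier square \<open>j\<close> of
  side \<open>d\<close> blocks it: its top is above \<open>y + c\<close> and its horizontal distance from \<open>x\<close> is less than
  \<open>c\<close>. If \<open>j\<close> starts at or below \<open>y\<close>, then \<open>d > c\<close>, and \<open>j\<close> or one of its two horizontal neighbours
  contains the point. If \<open>j\<close> starts in \<open>{y<..y + d}\<close>, then \<open>2 * d > c\<close>, and the point lies in one
  of the five copies of \<open>j\<close> in the row just below \<open>j\<close>. Otherwise \<open>j\<close> is again placed above \<open>y + d\<close>,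
  and one descends in the ordering. The descent starts with the topmost square. This uses seven
  copies of each square.\<close>

definition neighbours :: "point \<Rightarrow> real \<Rightarrow> point list" where
  "neighbours p a =
     map (\<lambda>m. (fst p + m * a, snd p)) [-1, 1] @
     map (\<lambda>m. (fst p + m * a, snd p - a)) [-2, -1, 0, 1, 2]"

lemma beside_covered:
  assumes "(x, y) \<notin> sq p a"
    and "snd p \<le> y" "y \<le> snd p + a"
    and "fst p \<le> x + a" "x \<le> fst p + 2 * a"
  shows "(x, y) \<in> (\<Union>t \<in> set (neighbours p a). sq t a)"
  using assms by (auto simp: neighbours_def sq_def)

lemma below_covered:
  assumes "y \<le> snd p" "snd p \<le> y + a"
    and "fst p \<le> x + 2 * a" "x \<le> fst p + 3 * a"
  shows "(x, y) \<in> (\<Union>t \<in> set (neighbours p a). sq t a)"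
proof -
  consider "x \<le> fst p - a" | "fst p - a \<le> x" "x \<le> fst p" | "fst p \<le> x" "x \<le> fst p + a"
    | "fst p + a \<le> x" "x \<le> fst p + 2 * a" | "fst p + 2 * a \<le> x"
    by linarith
  then show ?thesis
    using assms by cases (auto simp: neighbours_def sq_def)
qed

lemma exists_blocking_square:
  assumes "bl_packing W s pos" "k < length s" "s ! k \<le> W"
    and "0 \<le> x" "x \<le> W" "0 \<le> h" "h < snd (pos k)"
  obtains j where "j < k" "h < snd (pos j) + s ! j"
    "fst (pos j) < x + s ! k" "x < fst (pos j) + s ! j + s ! k"
proof -
  define c where "c = s ! k"
  \<comment> \<open>Clamping at \<open>0\<close> keeps the square inside the strip, as
    \<open>x\<close> and \<open>c\<close> are at most \<open>W\<close>, and keeps \<open>x\<close>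
    within its base.\<close>
  define p where "p = (max 0 (x - c), h)"
  have "\<not> feasible W s pos k p"
    using assms(1,2,7) by (force simp: bl_packing_def p_def)
  moreover have "0 \<le> fst p" "fst p + c \<le> W" "0 \<le> snd p"
    using assms by (auto simp: p_def c_def)
  ultimately obtain j where "j < k" and ne: "sq_int p c \<inter> sq_int (pos j) (s ! j) \<noteq> {}"
    unfolding feasible_def c_def by blast
  from ne obtain u v where
    "fst p < u" "u < fst p + c" "h < v"
    "fst (pos j) < u" "u < fst (pos j) + s ! j" "v < snd (pos j) + s ! j"
    unfolding sq_int_def by (auto simp: p_def[THEN arg_cong, of snd])
  moreover have "x - c \<le> fst p" "fst p \<le> x"
    using assms calculation by (auto simp: p_def)
  ultimately show thesis
    using \<open>j < k\<close> by (intro that[of j]) (auto simp: c_def)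
qed

lemma covered_below_placed_square:
  assumes "valid_instance W s" "bl_packing W s pos"
    and "0 \<le> x" "x \<le> W" "0 \<le> y"
    and free: "(x, y) \<notin> (\<Union>i<length s. sq (pos i) (s ! i))"
    and "k < length s" "y + s ! k < snd (pos k)"
  shows "(x, y) \<in> (\<Union>i<length s. \<Union>t \<in> set (neighbours (pos i) (s ! i)). sq t (s ! i))"
  using assms(7,8)
proof (induction k rule: less_induct)
  case (less k)
  have "0 < s ! k" "s ! k \<le> W"
    using assms(1) less.prems(1) by (auto simp: valid_instance_def)
  then obtain j where j: "j < k" "y + s ! k < snd (pos j) + s ! j"
    "fst (pos j) < x + s ! k" "x < fst (pos j) + s ! j + s ! k"
    using exists_blocking_square[OF assms(2) less.prems(1), of x "y + s ! k"] assms less.prems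
    by auto
  have j_len: "j < length s"
    using j(1) less.prems(1) by simp
  consider "snd (pos j) \<le> y" | "y < snd (pos j)" "snd (pos j) \<le> y + s ! j"
    | "y + s ! j < snd (pos j)"
    by linarith
  then show ?case
  proof cases
    case 1
    have "(x, y) \<in> (\<Union>t \<in> set (neighbours (pos j) (s ! j)). sq t (s ! j))"
      using free j_len 1 j \<open>0 < s ! k\<close> by (intro beside_covered) auto
    with j_len show ?thesis by blast
  next
    case 2
    \<comment> \<open>From \<open>y + s ! k < snd (pos j) + s ! j \<le> y + 2 * s ! j\<close>, reach
      \<open>s ! k\<close> is less than two copies on either side.\<close>
    have "(x, y) \<in> (\<Union>t \<in> set (neighbours (pos j) (s ! j)). sq t (s ! j))"
      using 2 j by (intro below_covered) auto
    with j_len show ?thesis by blast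
  next
    case 3
    with less.IH j(1) j_len show ?thesis by blast
  qed
qed

theorem theorem13:
  fixes W :: real and s :: "real list" and pos :: "nat \<Rightarrow> point"
  assumes "valid_instance W s"
    and "s \<noteq> []"
    and "bl_packing W s pos"
  shows "\<exists>T :: nat \<Rightarrow> point list.
           (\<forall>i < length s. length (T i) \<le> 12) \<and>
           ({0..W} \<times> {0 .. h_BL s pos - 3 * h_max s}) - (\<Union>i<length s. sq (pos i) (s ! i))
             \<subseteq> (\<Union>i<length s. \<Union>t \<in> set (T i). sq t (s ! i))"
proof -
  have "h_BL s pos \<in> (\<lambda>i. snd (pos i) + s ! i) ` {..<length s}"
    unfolding h_BL_def setcompr_eq_image lessThan_def using assms(2) by (intro Max_in) auto
  then obtain q where q: "q < length s" "h_BL s pos = snd (pos q) + s ! q"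
    by auto
  have "s ! q \<le> h_max s" "0 < s ! q"
    using q(1) assms(1) by (auto simp: h_max_def valid_instance_def)
  \<comment> \<open>The descent can start at \<open>q\<close>: \<open>y + s ! q \<le> snd (pos q) +
    2 * s ! q - 3 * h_max s < snd (pos q)\<close>.\<close>
  then have "(x, y) \<in> (\<Union>i<length s. \<Union>t \<in> set (neighbours (pos i) (s ! i)). sq t (s ! i))"
    if "0 \<le> x" "x \<le> W" "0 \<le> y" "y \<le> h_BL s pos - 3 * h_max s"
      "(x, y) \<notin> (\<Union>i<length s. sq (pos i) (s ! i))" for x y
    using that q(2) by (intro covered_below_placed_square[OF assms(1,3) _ _ _ _ q(1)]) auto
  moreover have "length (neighbours (pos i) (s ! i)) \<le> 12" for i
    by (simp add: neighbours_def)
  ultimately show ?thesis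
    by (intro exI[of _ "\<lambda>i. neighbours (pos i) (s ! i)"]) auto
qed

end
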